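(* For every positive integer $n$, the set $\mathscr{C}_{F_{2k}}(n)$ of compositions of $n$ in which each part equal to $k$ comes in $F_{2k}$ colors is in one-to-one correspondence with the set of spanning trees of the $n$-ladder graph $L_n$, and these sets are also equinumerous with the set of words of length $n-1$ over the alphabet $\{0,1,2,3\}$ that do not contain $01$ as a factor (two consecutive letters). These sets are enumerated by the sequence $1,4,15,56,209,780,2911,10864,\dots$, i.e. their common cardinality $a_n$ satisfies $a_1=1$, $a_2=4$, $a_n=4a_{n-1}-a_{n-2}$ for $n\ge3$.
   Context: $F_0=0$, $F_1=1$, $F_n=F_{n-1}+F_{n-2}$ are the Fibonacci numbers. A $w$-colored composition of $n$ (for a sequence $(w_k)$ of nonnegative integers) is a composition $(j_1,\dots,j_m)$ of $n$ together with a choice of one of $w_{j_i}$ colors for each part $j_i$; $\mathscr{C}_{w_k}(n)$ is the set of these. The $n$-ladder graph $L_n$ is the $n\times 2$ grid graph (the Cartesian product of a path on $n$ vertices with a path on $2$ vertices), with $2n$ vertices and $3n-2$ edges; a spanning tree is a set of $2n-1$ edges forming a tree on all vertices. *)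

theory Defs
  imports Complex_Main "HOL-Library.Sublist" "HOL-Number_Theory.Fib"
begin

text \<open>A \<open>w\<close>-colored composition is the list of its colored parts \<open>(j, c)\<close>, where a part \<open>j\<close> has
  the colors \<open>0, \<dots>, w j - 1\<close>.\<close>

definition colored_compositions :: "(nat \<Rightarrow> nat) \<Rightarrow> nat \<Rightarrow> (nat \<times> nat) list set" where
  "colored_compositions w n =
     {xs. (\<forall>(j, c) \<in> set xs. 1 \<le> j \<and> c < w j) \<and> sum_list (map fst xs) = n}"

text \<open>Finite simple graphs are pairs of a vertex set and a set of two-element edges. The trees of
  the entry \<open>Graph_Theory\<close> are not used here: its cycles follow the directions of the arcs, so a
  bidirected edge already is a cycle of length two.\<close>

type_synonym 'a graph = "'a set \<times> 'a set set"

definition path_graph :: "nat \<Rightarrow> nat graph" where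
  "path_graph n = ({1..n}, {{i, i + 1} | i. 1 \<le> i \<and> i + 1 \<le> n})"

definition cartesian_product :: "'a graph \<Rightarrow> 'b graph \<Rightarrow> ('a \<times> 'b) graph" where
  "cartesian_product G H =
     (fst G \<times> fst H,
      {{(u, x), (u, y)} | u x y. u \<in> fst G \<and> {x, y} \<in> snd H} \<union>
      {{(u, x), (v, x)} | u v x. {u, v} \<in> snd G \<and> x \<in> fst H})"

definition ladder :: "nat \<Rightarrow> (nat \<times> nat) graph" where
  "ladder n = cartesian_product (path_graph n) (path_graph 2)"

definition connected_graph :: "'a graph \<Rightarrow> bool" where
  "connected_graph G \<longleftrightarrow> fst G \<noteq> {} \<and>
     (\<forall>u \<in> fst G. \<forall>v \<in> fst G. (u, v) \<in> {(x, y). {x, y} \<in> snd G}\<^sup>*)"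

text \<open>The vertices of a cycle are listed once, without repeating the first one at the end.\<close>

definition is_cycle :: "'a graph \<Rightarrow> 'a list \<Rightarrow> bool" where
  "is_cycle G p \<longleftrightarrow> 3 \<le> length p \<and> distinct p \<and>
     (\<forall>i < length p. {p ! i, p ! (Suc i mod length p)} \<in> snd G)"

definition is_tree :: "'a graph \<Rightarrow> bool" where
  "is_tree G \<longleftrightarrow> connected_graph G \<and> (\<nexists>p. is_cycle G p)"

definition spanning_trees :: "'a graph \<Rightarrow> 'a set set set" where
  "spanning_trees G = {T. T \<subseteq> snd G \<and> card T = card (fst G) - 1 \<and> is_tree (fst G, T)}"

definition words_avoiding_01 :: "nat \<Rightarrow> nat list set" where
  "words_avoiding_01 m = {u. length u = m \<and> set u \<subseteq> {0, 1, 2, 3} \<and> \<not> sublist [0, 1] u}"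

end

theory Submission
  imports Defs
begin

text \<open>All three counts satisfy \<open>x\<^sub>n\<^sub>+\<^sub>2 = 4 x\<^sub>n\<^sub>+\<^sub>1 - x\<^sub>n\<close> with the same two initial values. For words,
  prepend a letter and discard the words that start with \<open>01\<close>. For compositions, split off the
  first part and use \<open>F\<^sub>2\<^sub>k\<^sub>+\<^sub>4 = 3 F\<^sub>2\<^sub>k\<^sub>+\<^sub>2 - F\<^sub>2\<^sub>k\<close>. For spanning trees, let \<open>s\<^sub>n\<close> count all of them and
  \<open>f\<^sub>n\<close> those that contain the last rung. A spanning tree of the next ladder contains either exactly
  two of the three new edges, and then the remaining edges form a spanning tree of the old ladder, or
  all three, and then contracting them to the old last rung gives a spanning tree containing that
  rung. Hence \<open>s\<^sub>n\<^sub>+\<^sub>1 = 3 s\<^sub>n + f\<^sub>n\<close> and \<open>f\<^sub>n\<^sub>+\<^sub>1 = 2 s\<^sub>n + f\<^sub>n\<close>. Acyclicity never has to be tracked: a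
  connected graph has at least \<open>|V| - 1\<close> edges, and deleting an edge of a cycle keeps it connected,
  so a connected graph with exactly \<open>|V| - 1\<close> edges is a tree.\<close>

section \<open>Connectivity and spanning trees\<close>

text \<open>Such a predicate is the indicator of a union of components. Working with predicates
  replaces the handling of paths: when a graph is modified, a predicate only has to be extended or
  restricted.\<close>

definition respects_edges :: "'a set set \<Rightarrow> ('a \<Rightarrow> bool) \<Rightarrow> bool" where
  "respects_edges E P \<longleftrightarrow> (\<forall>x y. {x, y} \<in> E \<longrightarrow> P x = P y)"

lemma respects_edges_insert:
  "respects_edges (insert {x, y} E) P \<longleftrightarrow> P x = P y \<and> respects_edges E P"
  by (auto simp: respects_edges_def doubleton_eq_iff)

lemma respects_edges_cong:
  assumes "\<And>x. x \<in> \<Union>E \<Longrightarrow> P x = Q x"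
  shows "respects_edges E P \<longleftrightarrow> respects_edges E Q"
  using assms unfolding respects_edges_def by blast

text \<open>A predicate that respects edges propagates along every walk. Conversely, reachability
  from \<open>u\<close> is such a predicate, because edges are unordered, and it holds at
  \<open>u\<close> itself.\<close>

lemma connected_graph_iff:
  "connected_graph (V, E) \<longleftrightarrow>
     V \<noteq> {} \<and> (\<forall>P. respects_edges E P \<longrightarrow> (\<forall>u \<in> V. \<forall>v \<in> V. P u = P v))"
proof -
  let ?R = "{(x, y). {x, y} \<in> E}"
  have P: "P u = P v" if "(u, v) \<in> ?R\<^sup>*" "respects_edges E P" for P u v
    using that by induction (auto simp: respects_edges_def)
  have R: "(u, v) \<in> ?R\<^sup>*"
    if all: "\<forall>P. respects_edges E P \<longrightarrow> (\<forall>u \<in> V. \<forall>v \<in> V. P u = P v)"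
      and uv: "u \<in> V" "v \<in> V" for u v
  proof -
    have "respects_edges E (\<lambda>x. (u, x) \<in> ?R\<^sup>*)"
      unfolding respects_edges_def
      by (auto intro: rtrancl.rtrancl_into_rtrancl simp: insert_commute)
    with all uv have "((u, u) \<in> ?R\<^sup>*) = ((u, v) \<in> ?R\<^sup>*)"
      by blast
    then show ?thesis by simp
  qed
  have "(\<forall>u \<in> V. \<forall>v \<in> V. (u, v) \<in> ?R\<^sup>*) \<longleftrightarrow>
      (\<forall>P. respects_edges E P \<longrightarrow> (\<forall>u \<in> V. \<forall>v \<in> V. P u = P v))"
  proof
    assume reach: "\<forall>u \<in> V. \<forall>v \<in> V. (u, v) \<in> ?R\<^sup>*"
    show "\<forall>P. respects_edges E P \<longrightarrow> (\<forall>u \<in> V. \<forall>v \<in> V. P u = P v)"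
    proof (rule allI, rule impI, rule ballI, rule ballI)
      fix P u v
      assume "respects_edges E P" "u \<in> V" "v \<in> V"
      then show "P u = P v" using P[of u v P] reach by simp
    qed
  next
    assume "\<forall>P. respects_edges E P \<longrightarrow> (\<forall>u \<in> V. \<forall>v \<in> V. P u = P v)"
    then show "\<forall>u \<in> V. \<forall>v \<in> V. (u, v) \<in> ?R\<^sup>*"
      by (intro ballI R)
  qed
  then show ?thesis by (simp add: connected_graph_def)
qed

section \<open>Edge counts and acyclicity of connected graphs\<close>

text \<open>Growth from a single vertex: while \<open>A\<close> is a proper subset of
  \<open>V\<close>, membership in \<open>A\<close> cannot respect all edges, so some edge leaves
  \<open>A\<close>. Adding its outer endpoint brings at least this edge inside.\<close>

lemma connected_graph_grow:
  assumes "connected_graph (V, E)" "finite V" "\<Union>E \<subseteq> V" "finite E" "k < card V"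
  shows "\<exists>A \<subseteq> V. card A = Suc k \<and> k \<le> card {e \<in> E. e \<subseteq> A}"
  using assms(5)
proof (induction k)
  case 0
  then obtain v where "v \<in> V" by (metis card.empty ex_in_conv less_irrefl)
  then show ?case by (intro exI[of _ "{v}"]) auto
next
  case (Suc k)
  then obtain A where A: "A \<subseteq> V" "card A = Suc k" "k \<le> card {e \<in> E. e \<subseteq> A}"
    by auto
  have "finite A" using A by (metis card.infinite nat.simps(3))
  obtain u where "u \<in> A" using A by fastforce
  moreover obtain v where "v \<in> V" "v \<notin> A"
    using A Suc.prems by (metis less_irrefl subsetI subset_antisym)
  ultimately have "\<not> respects_edges E (\<lambda>x. x \<in> A)"
    using assms(1) A unfolding connected_graph_iff by blast
  then obtain x y where xy: "{x, y} \<in> E" "x \<in> A" "y \<notin> A"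
    unfolding respects_edges_def by (metis insert_commute)
  let ?B = "insert y A"
  have "{e \<in> E. e \<subseteq> ?B} \<supseteq> insert {x, y} {e \<in> E. e \<subseteq> A}"
    using xy by auto
  then have "card (insert {x, y} {e \<in> E. e \<subseteq> A}) \<le> card {e \<in> E. e \<subseteq> ?B}"
    using assms(4) by (intro card_mono) auto
  then have "Suc k \<le> card {e \<in> E. e \<subseteq> ?B}"
    using A xy assms(4) by (subst (asm) card_insert_disjoint) auto
  moreover have "?B \<subseteq> V" "card ?B = Suc (Suc k)"
    using A xy assms(3) \<open>finite A\<close> by auto
  ultimately show ?case by blast
qed

lemma connected_graph_card_le:
  assumes "connected_graph (V, E)" "finite V" "\<Union>E \<subseteq> V"
  shows "card V \<le> Suc (card E)"
proof -
  have fin: "finite E" using assms by (simp add: finite_UnionD finite_subset)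
  show ?thesis
  proof (cases "card V")
    case (Suc k)
    then obtain A where "k \<le> card {e \<in> E. e \<subseteq> A}"
      using connected_graph_grow[OF assms fin, of k] by auto
    also have "\<dots> \<le> card E" using fin by (intro card_mono) auto
    finally show ?thesis using Suc by simp
  qed simp
qed

text \<open>The rest of the cycle still joins the ends of the deleted edge, so a predicate that
  respects the remaining edges respects the deleted one as well.\<close>

lemma connected_graph_remove_cycle_edge:
  assumes "connected_graph (V, E)" "is_cycle (V, E) p"
  obtains e where "e \<in> E" "connected_graph (V, E - {e})"
proof -
  define k where "k = length p - 1"
  have k: "length p = Suc k" "2 \<le> k" and dist: "distinct p"
    using assms(2) by (auto simp: is_cycle_def k_def)
  have edge: "{p ! i, p ! (Suc i mod Suc k)} \<in> E" if "i < Suc k" for i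
    using assms(2) k that by (auto simp: is_cycle_def)
  \<comment> \<open>The wrap-around edge is the one deleted, so that the remaining path runs through
    the plain indices \<open>0\<close> to \<open>k\<close>.\<close>
  let ?e = "{p ! k, p ! 0}"
  have "?e \<in> E" using edge[of k] by simp
  moreover have "connected_graph (V, E - {?e})"
  proof -
    have "respects_edges E P" if P: "respects_edges (E - {?e}) P" for P
    proof -
      have "i \<le> k \<Longrightarrow> P (p ! i) = P (p ! 0)" for i
      proof (induction i)
        case (Suc i)
        have "{p ! i, p ! Suc i} \<in> E" using edge[of i] Suc.prems by simp
        \<comment> \<open>Length at least three enters here: on two vertices the only path edge
          would be the closing edge.\<close>
        moreover have "{p ! i, p ! Suc i} \<noteq> ?e"
          using dist k Suc.prems by (auto simp: doubleton_eq_iff nth_eq_iff_index_eq)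
        ultimately have "P (p ! i) = P (p ! Suc i)"
          using P by (simp add: respects_edges_def)
        then show ?case using Suc by simp
      qed simp
      then have "P (p ! k) = P (p ! 0)" by blast
      then show ?thesis
        using P unfolding respects_edges_def by (auto simp: doubleton_eq_iff)
    qed
    then show ?thesis using assms(1) by (simp add: connected_graph_iff)
  qed
  ultimately show ?thesis using that by blast
qed

lemma is_tree_if_card:
  assumes "connected_graph (V, E)" "finite V" "\<Union>E \<subseteq> V" "Suc (card E) = card V"
  shows "is_tree (V, E)"
proof -
  have fin: "finite E" using assms by (simp add: finite_UnionD finite_subset)
  have "\<not> is_cycle (V, E) p" for p
  proof
    assume "is_cycle (V, E) p"
    then obtain e where e: "e \<in> E" "connected_graph (V, E - {e})"
      using connected_graph_remove_cycle_edge assms(1) by metis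
    then have "card V \<le> Suc (card (E - {e}))"
      using assms by (intro connected_graph_card_le) auto
    moreover have "card (E - {e}) < card E" using e fin by (intro card_Diff1_less)
    ultimately show False using assms(4) by simp
  qed
  then show ?thesis using assms(1) by (simp add: is_tree_def)
qed

text \<open>Connectedness and the edge count force acyclicity, so later graph surgery only has to
  follow these two.\<close>

lemma spanning_trees_iff:
  assumes "finite V" "\<Union>E \<subseteq> V"
  shows "T \<in> spanning_trees (V, E) \<longleftrightarrow>
    T \<subseteq> E \<and> Suc (card T) = card V \<and> connected_graph (V, T)"
proof -
  have "is_tree (V, T)" if "T \<subseteq> E" "Suc (card T) = card V" "connected_graph (V, T)"
    using that assms by (intro is_tree_if_card) auto
  \<comment> \<open>Nonemptiness turns the truncated \<open>card V - 1\<close> of the definition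
    into the equation with \<open>Suc\<close>.\<close>
  moreover have "V \<noteq> {}" if "is_tree (V, T)"
    using that by (simp add: is_tree_def connected_graph_def)
  ultimately show ?thesis
    using assms(1) by (auto simp: spanning_trees_def is_tree_def card_gt_0_iff)
qed

section \<open>Operations that preserve connectivity\<close>

text \<open>The new edge forces \<open>P v = P u\<close>, so each predicate respecting the old edges
  has exactly one value at \<open>v\<close> that respects the new one.\<close>

lemma connected_graph_leaf:
  assumes "\<Union>E \<subseteq> V" "u \<in> V" "v \<notin> V"
  shows "connected_graph (insert v V, insert {u, v} E) \<longleftrightarrow> connected_graph (V, E)"
proof -
  have ext: "respects_edges (insert {u, v} E) (P(v := P u))" if "respects_edges E P" for P
  proof -
    have "respects_edges E (P(v := P u)) \<longleftrightarrow> respects_edges E P"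
      using assms by (intro respects_edges_cong) auto
    then show ?thesis using that assms by (auto simp: respects_edges_insert)
  qed
  have res: "respects_edges E P \<and> P v = P u" if "respects_edges (insert {u, v} E) P" for P
    using that by (simp add: respects_edges_insert)
  show ?thesis
  proof
    assume c: "connected_graph (insert v V, insert {u, v} E)"
    have "P x = P y" if "respects_edges E P" "x \<in> V" "y \<in> V" for P x y
    proof -
      have "(P(v := P u)) x = (P(v := P u)) y"
        using c ext that unfolding connected_graph_iff by blast
      then show ?thesis using that assms by (auto split: if_splits)
    qed
    then show "connected_graph (V, E)"
      using assms unfolding connected_graph_iff by blast
  next
    assume "connected_graph (V, E)"
    then have "P x = P u" if "respects_edges (insert {u, v} E) P" "x \<in> insert v V" for P x
      using res[OF that(1)] that(2) assms(2) unfolding connected_graph_iff by blast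
    then show "connected_graph (insert v V, insert {u, v} E)"
      unfolding connected_graph_iff by blast
  qed
qed

text \<open>The path \<open>a\<close>, \<open>a'\<close>, \<open>b'\<close>, \<open>b\<close>
  imposes \<open>P a = P b\<close>, just as the edge \<open>{a, b}\<close> does, and determines
  \<open>P\<close> at the two inner vertices. This is the contraction of three new edges to one
  rung.\<close>

lemma connected_graph_subdivide:
  assumes "\<Union>E \<subseteq> V" "a \<in> V" "b \<in> V" "a' \<notin> V" "b' \<notin> V" "a' \<noteq> b'"
  shows "connected_graph (insert a' (insert b' V), insert {a, a'} (insert {b, b'} (insert {a', b'} E)))
    \<longleftrightarrow> connected_graph (V, insert {a, b} E)" (is "connected_graph (?V', ?E') \<longleftrightarrow> _")
proof -
  have ext: "respects_edges ?E' (P(a' := P a, b' := P a))"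
    if "respects_edges (insert {a, b} E) P" for P
  proof -
    have "respects_edges E (P(a' := P a, b' := P a)) \<longleftrightarrow> respects_edges E P"
      using assms by (intro respects_edges_cong) auto
    then show ?thesis using that assms by (auto simp: respects_edges_insert)
  qed
  have res: "respects_edges (insert {a, b} E) P \<and> P a' = P a \<and> P b' = P a"
    if "respects_edges ?E' P" for P
    using that by (simp add: respects_edges_insert)
  show ?thesis
  proof
    assume c: "connected_graph (?V', ?E')"
    have "P u = P v" if "respects_edges (insert {a, b} E) P" "u \<in> V" "v \<in> V" for P u v
    proof -
      have "(P(a' := P a, b' := P a)) u = (P(a' := P a, b' := P a)) v"
        using c ext that unfolding connected_graph_iff by blast
      then show ?thesis using that assms by (auto split: if_splits)
    qed
    then show "connected_graph (V, insert {a, b} E)"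
      using assms unfolding connected_graph_iff by blast
  next
    assume "connected_graph (V, insert {a, b} E)"
    then have "P u = P a" if "respects_edges ?E' P" "u \<in> ?V'" for P u
      using res[OF that(1)] that(2) assms(2) unfolding connected_graph_iff by blast
    then show "connected_graph (?V', ?E')"
      unfolding connected_graph_iff by blast
  qed
qed

lemma connected_graph_crossing_edge:
  assumes "connected_graph (V, E)" "u \<in> V" "v \<in> V" "u \<in> A" "v \<notin> A"
  obtains x y where "{x, y} \<in> E" "x \<in> A" "y \<notin> A"
proof -
  have "\<not> respects_edges E (\<lambda>x. x \<in> A)"
    using assms unfolding connected_graph_iff by blast
  then show ?thesis
    using that unfolding respects_edges_def by (metis insert_commute)
qed

section \<open>Gluing a square along an existing edge\<close>

context
  fixes V :: "'a set" and E a b a' b'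
  assumes fin: "finite V" and sub: "\<Union>E \<subseteq> V"
    and ab: "a \<in> V" "b \<in> V" "{a, b} \<in> E"
    and new: "a' \<notin> V" "b' \<notin> V" "a' \<noteq> b'"
begin

lemma attach_square_new_edges:
  "{a, a'} \<notin> E" "{b, b'} \<notin> E" "{a', b'} \<notin> E"
  "{a, a'} \<noteq> {b, b'}" "{a, a'} \<noteq> {a', b'}" "{b, b'} \<noteq> {a', b'}"
proof -
  have "e \<notin> E" if "a' \<in> e \<or> b' \<in> e" for e using that sub new by blast
  then show "{a, a'} \<notin> E" "{b, b'} \<notin> E" "{a', b'} \<notin> E" by blast+
  show "{a, a'} \<noteq> {b, b'}" "{a, a'} \<noteq> {a', b'}" "{b, b'} \<noteq> {a', b'}"
    using ab(1,2) new unfolding doubleton_eq_iff by blast+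
qed

text \<open>For each pair, the two new vertices can be attached one after the other as leaves; only
  the order and the anchor of each leaf vary.\<close>

lemma attach_square_two_edges:
  assumes "T \<subseteq> E" "X \<in> {{{a, a'}, {b, b'}}, {{a, a'}, {a', b'}}, {{b, b'}, {a', b'}}}"
  shows "connected_graph (insert a' (insert b' V), X \<union> T) \<longleftrightarrow> connected_graph (V, T)"
proof -
  have T: "\<Union>T \<subseteq> V" using assms sub by auto
  have 1: "connected_graph (insert a' (insert b' V), {{a, a'}, {b, b'}} \<union> T) \<longleftrightarrow> connected_graph (V, T)"
    using connected_graph_leaf[of T V b b'] connected_graph_leaf[of "insert {b, b'} T" "insert b' V" a a']
      T ab new by auto
  have 2: "connected_graph (insert a' (insert b' V), {{a, a'}, {a', b'}} \<union> T) \<longleftrightarrow> connected_graph (V, T)"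
    using connected_graph_leaf[of T V a a'] connected_graph_leaf[of "insert {a, a'} T" "insert a' V" a' b']
      T ab new by (auto simp: insert_commute)
  have 3: "connected_graph (insert a' (insert b' V), {{b, b'}, {a', b'}} \<union> T) \<longleftrightarrow> connected_graph (V, T)"
    using connected_graph_leaf[of T V b b'] connected_graph_leaf[of "insert {b, b'} T" "insert b' V" b' a']
      T ab new by (auto simp: insert_commute)
  show ?thesis using assms(2) 1 2 3 by auto
qed

text \<open>Three cuts decide: an edge must leave \<open>{a'}\<close>, another \<open>{b'}\<close>,
  and another \<open>V\<close>. Each cut is crossed by exactly two of the new edges and by none of
  \<open>T\<close>, so at most one new edge is missing.\<close>

lemma attach_square_two_of_three:
  assumes "T \<subseteq> E" "X \<subseteq> {{a, a'}, {b, b'}, {a', b'}}"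
    and con: "connected_graph (insert a' (insert b' V), X \<union> T)"
  shows "X \<in> {{{a, a'}, {b, b'}}, {{a, a'}, {a', b'}}, {{b, b'}, {a', b'}}} \<or>
    X = {{a, a'}, {b, b'}, {a', b'}}"
proof -
  have T: "e \<subseteq> V" if "e \<in> T" for e using assms sub that by auto
  have "{a, a'} \<in> X \<or> {a', b'} \<in> X"
  proof -
    obtain x y where xy: "{x, y} \<in> X \<union> T" "x \<in> {a'}" "y \<notin> {a'}"
      using connected_graph_crossing_edge[OF con, of a' a "{a'}"] ab new by auto
    then show ?thesis using T[of "{x, y}"] assms(2) new ab by (auto simp: doubleton_eq_iff)
  qed
  moreover have "{b, b'} \<in> X \<or> {a', b'} \<in> X"
  proof -
    obtain x y where xy: "{x, y} \<in> X \<union> T" "x \<in> {b'}" "y \<notin> {b'}"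
      using connected_graph_crossing_edge[OF con, of b' b "{b'}"] ab new by auto
    then show ?thesis using T[of "{x, y}"] assms(2) new ab by (auto simp: doubleton_eq_iff)
  qed
  moreover have "{a, a'} \<in> X \<or> {b, b'} \<in> X"
  proof -
    obtain x y where xy: "{x, y} \<in> X \<union> T" "x \<in> V" "y \<notin> V"
      using connected_graph_crossing_edge[OF con, of a a' V] ab new by auto
    then show ?thesis using T[of "{x, y}"] assms(2) new ab by (auto simp: doubleton_eq_iff)
  qed
  moreover have "X \<in> {{t, s}, {t, r}, {s, r}} \<or> X = {t, s, r}"
    if X: "X \<subseteq> {t, s, r}" and two: "t \<in> X \<or> r \<in> X" "s \<in> X \<or> r \<in> X" "t \<in> X \<or> s \<in> X" for t s r
  proof -
    consider "t \<in> X" "s \<in> X" "r \<in> X" | "t \<in> X" "s \<in> X" "r \<notin> X"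
      | "t \<in> X" "s \<notin> X" "r \<in> X" | "t \<notin> X" "s \<in> X" "r \<in> X"
      using two by blast
    then show ?thesis
    proof cases
      case 1
      then have "X = {t, s, r}" using X by blast
      then show ?thesis by (rule disjI2)
    next
      case 2
      then have "X = {t, s}" using X by blast
      then show ?thesis by simp
    next
      case 3
      then have "X = {t, r}" using X by blast
      then show ?thesis by simp
    next
      case 4
      then have "X = {s, r}" using X by blast
      then show ?thesis by simp
    qed
  qed
  ultimately show ?thesis using assms(2) by metis
qed

text \<open>The three leaf cases keep the old tree intact. With all three new edges present,
  \<open>{a, b}\<close> would close a cycle; it is therefore absent, and restoring it in place of
  the path gives the old tree.\<close>

lemma spanning_trees_attach_square:
  defines "\<T> \<equiv> spanning_trees (V, E)"
  shows "spanning_trees (insert a' (insert b' V), insert {a, a'} (insert {b, b'} (insert {a', b'} E))) =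
    (\<lambda>T. {{a, a'}, {b, b'}} \<union> T) ` \<T> \<union>
    ((\<lambda>T. {{a, a'}, {a', b'}} \<union> T) ` \<T> \<union>
    ((\<lambda>T. {{b, b'}, {a', b'}} \<union> T) ` \<T> \<union>
     (\<lambda>T. {{a, a'}, {b, b'}, {a', b'}} \<union> (T - {{a, b}})) ` {T \<in> \<T>. {a, b} \<in> T}))"
    (is "spanning_trees (?V', ?E') = ?R")
proof -
  let ?t = "{a, a'}" and ?s = "{b, b'}" and ?r = "{a', b'}"
  have finE: "finite E" using fin sub by (simp add: finite_UnionD finite_subset)
  have tree: "T \<in> \<T> \<longleftrightarrow> T \<subseteq> E \<and> Suc (card T) = card V \<and> connected_graph (V, T)" for T
    unfolding \<T>_def by (rule spanning_trees_iff[OF fin sub])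
  have tree': "T \<in> spanning_trees (?V', ?E') \<longleftrightarrow>
      T \<subseteq> ?E' \<and> Suc (card T) = card ?V' \<and> connected_graph (?V', T)" for T
    by (rule spanning_trees_iff) (use fin sub ab in auto)
  have V': "card ?V' = Suc (Suc (card V))" using fin new by simp
  have two: "X \<union> T \<in> spanning_trees (?V', ?E') \<longleftrightarrow> T \<in> \<T>"
    if "T \<subseteq> E" "X \<in> {{?t, ?s}, {?t, ?r}, {?s, ?r}}" for X T
  proof -
    have "card (X \<union> T) = card X + card T"
      using that attach_square_new_edges finite_subset[OF that(1) finE]
      by (intro card_Un_disjoint) auto
    moreover have "card X = 2"
      using that(2) attach_square_new_edges(4-6) unfolding card_2_iff by blast
    ultimately show ?thesis
      using that attach_square_two_edges[OF that] V' unfolding tree tree' by auto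
  qed
  have three: "{?t, ?s, ?r} \<union> T \<in> spanning_trees (?V', ?E') \<longleftrightarrow>
      {a, b} \<notin> T \<and> insert {a, b} T \<in> \<T>" if "T \<subseteq> E" for T
  proof -
    have T: "\<Union>T \<subseteq> V" "finite T" using that sub finE by (auto intro: finite_subset)
    have "card ({?t, ?s, ?r} \<union> T) = card {?t, ?s, ?r} + card T"
      using that attach_square_new_edges T by (intro card_Un_disjoint) auto
    moreover have "card {?t, ?s, ?r} = 3"
      using attach_square_new_edges(4-6) unfolding card_3_iff by blast
    moreover have "connected_graph (?V', {?t, ?s, ?r} \<union> T) \<longleftrightarrow> connected_graph (V, insert {a, b} T)"
      using connected_graph_subdivide[OF T(1) ab(1,2) new] by simp
    \<comment> \<open>This excludes the case that \<open>{a, b}\<close> is in \<open>T\<close>: then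
      \<open>T\<close> would be connected with only \<open>card V - 2\<close> edges.\<close>
    moreover have "card V \<le> Suc (card (insert {a, b} T))" if "connected_graph (V, insert {a, b} T)"
      using that T ab fin by (intro connected_graph_card_le) auto
    ultimately show ?thesis
      using that V' T(2) ab(3) unfolding tree tree'
      by (cases "{a, b} \<in> T") (auto simp: insert_absorb)
  qed
  have sub\<T>: "T \<subseteq> E" if "T \<in> \<T>" for T using that tree by simp
  have R: "T \<in> ?R \<longleftrightarrow>
      (\<exists>X \<in> {{?t, ?s}, {?t, ?r}, {?s, ?r}}. \<exists>T0 \<in> \<T>. T = X \<union> T0) \<or>
      (\<exists>T0 \<in> {T \<in> \<T>. {a, b} \<in> T}. T = {?t, ?s, ?r} \<union> (T0 - {{a, b}}))" for T
    by (simp only: Un_iff image_iff bex_simps simp_thms disj_assoc)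
  show ?thesis
  proof (intro equalityI subsetI)
    fix T assume T: "T \<in> spanning_trees (?V', ?E')"
    define X where "X = T \<inter> {?t, ?s, ?r}"
    have T_eq: "T = X \<union> (T \<inter> E)" using T unfolding tree' X_def by auto
    then have "connected_graph (?V', X \<union> (T \<inter> E))" using T unfolding tree' by simp
    then have "X \<in> {{?t, ?s}, {?t, ?r}, {?s, ?r}} \<or> X = {?t, ?s, ?r}"
      by (intro attach_square_two_of_three) (auto simp: X_def)
    then consider "X \<in> {{?t, ?s}, {?t, ?r}, {?s, ?r}}" | "X = {?t, ?s, ?r}" by (elim disjE)
    then show "T \<in> ?R"
    proof cases
      case 1
      have "T \<inter> E \<in> \<T>"
        using two[OF Int_lower2 1, of T] T unfolding T_eq[symmetric] by (rule iffD1)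
      then show ?thesis unfolding R using T_eq 1 by (intro disjI1 bexI)
    next
      case 2
      then have ab_T: "{a, b} \<notin> T \<inter> E" "insert {a, b} (T \<inter> E) \<in> \<T>"
        using three[OF Int_lower2, of T] T T_eq by metis+
      have "T = {?t, ?s, ?r} \<union> (insert {a, b} (T \<inter> E) - {{a, b}})"
        unfolding Diff_insert_absorb[OF ab_T(1)] 2[symmetric] by (rule T_eq)
      then show ?thesis unfolding R using ab_T(2)
        by (intro disjI2 bexI[where x = "insert {a, b} (T \<inter> E)"] CollectI conjI insertI1)
    qed
  next
    fix T assume "T \<in> ?R"
    then show "T \<in> spanning_trees (?V', ?E')"
      unfolding R
    proof (elim disjE bexE)
      fix X T0
      assume "X \<in> {{?t, ?s}, {?t, ?r}, {?s, ?r}}" "T0 \<in> \<T>" and T: "T = X \<union> T0"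
      then show ?thesis unfolding T using two[OF sub\<T>] by metis
    next
      fix T0
      assume T0: "T0 \<in> {T \<in> \<T>. {a, b} \<in> T}" and T: "T = {?t, ?s, ?r} \<union> (T0 - {{a, b}})"
      then have "T0 - {{a, b}} \<subseteq> E" and ins: "insert {a, b} (T0 - {{a, b}}) = T0"
        using sub\<T>[of T0] by blast+
      then show ?thesis
        unfolding T three[OF \<open>T0 - {{a, b}} \<subseteq> E\<close>] ins using T0 by simp
    qed
  qed
qed

text \<open>The set of new edges in a tree tells the four families apart, and within a family the
  old tree can be recovered. Only \<open>?A\<close> omits the new rung, which lowers the coefficient
  from 3 to 2 in the second count.\<close>

lemma card_spanning_trees_attach_square:
  defines "\<T> \<equiv> spanning_trees (V, E)"
    and "\<T>' \<equiv> spanning_trees (insert a' (insert b' V), insert {a, a'} (insert {b, b'} (insert {a', b'} E)))"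
  shows "card \<T>' = 3 * card \<T> + card {T \<in> \<T>. {a, b} \<in> T}"
    and "card {T \<in> \<T>'. {a', b'} \<in> T} = 2 * card \<T> + card {T \<in> \<T>. {a, b} \<in> T}"
proof -
  let ?t = "{a, a'}" and ?s = "{b, b'}" and ?r = "{a', b'}"
  let ?F = "{T \<in> \<T>. {a, b} \<in> T}"
  let ?A = "(\<lambda>T. {?t, ?s} \<union> T) ` \<T>" and ?B = "(\<lambda>T. {?t, ?r} \<union> T) ` \<T>"
    and ?C = "(\<lambda>T. {?s, ?r} \<union> T) ` \<T>"
    and ?D = "(\<lambda>T. {?t, ?s, ?r} \<union> (T - {{a, b}})) ` ?F"
  have subE: "T \<subseteq> E" if "T \<in> \<T>" for T using that by (simp add: \<T>_def spanning_trees_def)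
  have "finite E" using fin sub by (simp add: finite_UnionD finite_subset)
  then have finT: "finite \<T>"
    using subE by (intro finite_subset[of \<T> "Pow E"]) auto
  note ne = attach_square_new_edges
  have notin: "?t \<notin> T" "?s \<notin> T" "?r \<notin> T" if "T \<in> \<T>" for T
    using subE[OF that] ne by auto
  have restrict: "inj_on (\<lambda>T. X \<union> T) \<T>" if "X \<subseteq> {?t, ?s, ?r}" for X
  proof (rule inj_on_inverseI[where g = "\<lambda>T. T - {?t, ?s, ?r}"])
    fix T assume "T \<in> \<T>"
    then show "X \<union> T - {?t, ?s, ?r} = T" using notin[of T] that by blast
  qed
  have cA: "card ?A = card \<T>" "card ?B = card \<T>" "card ?C = card \<T>"
    by (intro card_image restrict; blast)+
  \<comment> \<open>The inverse puts \<open>{a, b}\<close> back, which is correct because every tree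
    in \<open>?F\<close> contains it.\<close>
  have cD: "card ?D = card ?F"
  proof (intro card_image inj_on_inverseI[where g = "\<lambda>T. insert {a, b} (T - {?t, ?s, ?r})"])
    fix T assume "T \<in> ?F"
    then show "insert {a, b} ({?t, ?s, ?r} \<union> (T - {{a, b}}) - {?t, ?s, ?r}) = T"
      using notin[of T] by blast
  qed
  have A: "?r \<notin> T" if "T \<in> ?A" for T using that notin ne by auto
  have B: "?r \<in> T \<and> ?s \<notin> T" if "T \<in> ?B" for T using that notin ne by auto
  have C: "?r \<in> T \<and> ?s \<in> T \<and> ?t \<notin> T" if "T \<in> ?C" for T using that notin ne by auto
  have D: "?r \<in> T \<and> ?s \<in> T \<and> ?t \<in> T" if "T \<in> ?D" for T using that by auto
  have fins: "finite ?A" "finite ?B" "finite ?C" "finite ?D" using finT by auto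
  have disj: "T \<notin> ?C \<inter> ?D" "T \<notin> ?B \<inter> (?C \<union> ?D)" "T \<notin> ?A \<inter> (?B \<union> (?C \<union> ?D))" for T
    unfolding Int_iff Un_iff using A[of T] B[of T] C[of T] D[of T] by argo+
  have CD: "card (?C \<union> ?D) = card ?C + card ?D"
    by (intro card_Un_disjoint fins equals0I) (erule notE[OF disj(1)])
  have BCD: "card (?B \<union> (?C \<union> ?D)) = card ?B + card (?C \<union> ?D)"
    by (intro card_Un_disjoint fins finite_UnI equals0I) (erule notE[OF disj(2)])
  have ABCD: "card (?A \<union> (?B \<union> (?C \<union> ?D))) = card ?A + card (?B \<union> (?C \<union> ?D))"
    by (intro card_Un_disjoint fins finite_UnI equals0I) (erule notE[OF disj(3)])
  have T': "\<T>' = ?A \<union> (?B \<union> (?C \<union> ?D))"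
    unfolding \<T>'_def \<T>_def by (rule spanning_trees_attach_square)
  show "card \<T>' = 3 * card \<T> + card ?F"
    unfolding T' ABCD BCD CD cA cD by simp
  have T'_r: "{T \<in> \<T>'. ?r \<in> T} = ?B \<union> (?C \<union> ?D)"
  proof (rule set_eqI)
    show "T \<in> {T \<in> \<T>'. ?r \<in> T} \<longleftrightarrow> T \<in> ?B \<union> (?C \<union> ?D)" for T
      unfolding T' mem_Collect_eq Un_iff using A[of T] B[of T] C[of T] D[of T] by argo
  qed
  show "card {T \<in> \<T>'. ?r \<in> T} = 2 * card \<T> + card ?F"
    unfolding T'_r BCD CD cA cD by simp
qed

end

section \<open>The ladder\<close>

lemma ladder_vertices: "fst (ladder n) = {1..n} \<times> {1, 2}"
proof -
  have "{1..2::nat} = {1, 2}" by auto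
  then show ?thesis by (simp add: ladder_def cartesian_product_def path_graph_def)
qed

text \<open>Rungs are indexed by their column and rails by their left end, so that lengthening the
  ladder becomes inserting indices.\<close>

lemma ladder_edges:
  "snd (ladder n) = (\<lambda>i. {(i, 1), (i, 2)}) ` {1..n} \<union>
     (\<lambda>(i, x). {(i, x), (Suc i, x)}) ` ({1..<n} \<times> {1, 2})"
proof -
  have path: "snd (path_graph 2) = {{1, 2}}"
    by (auto simp: path_graph_def)
  have "{{(u, x), (u, y)} | u x y. u \<in> {1..n} \<and> {x, y} \<in> snd (path_graph 2)} =
      (\<lambda>i. {(i, 1), (i, 2)}) ` {1..n}" (is "?L = ?R")
  proof (intro equalityI subsetI)
    fix e assume "e \<in> ?L"
    then obtain u x y where e: "e = {(u, x), (u, y)}" "u \<in> {1..n}" and xy: "{x, y} = {1, 2}"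
      unfolding path by blast
    \<comment> \<open>Seeing \<open>e\<close> as the image of \<open>{x, y}\<close> avoids deciding
      which of the two is \<open>1\<close>.\<close>
    have "e = Pair u ` {x, y}" using e by simp
    then have "e = {(u, 1), (u, 2)}" unfolding xy by simp
    then show "e \<in> ?R" using e(2) by (rule image_eqI)
  qed (use path in blast)
  moreover have "{{(u, x), (v, x)} | u v x. {u, v} \<in> snd (path_graph n) \<and> x \<in> {1..2::nat}} =
      (\<lambda>(i, x). {(i, x), (Suc i, x)}) ` ({1..<n} \<times> {1, 2})"
    (is "?L = ?R")
  proof (intro equalityI subsetI)
    fix e assume "e \<in> ?L"
    then obtain u v x i where e: "e = {(u, x), (v, x)}" "x \<in> {1..2}"
      and i: "{u, v} = {i, Suc i}" "1 \<le> i" "Suc i \<le> n"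
      by (auto simp: path_graph_def)
    have "e = (\<lambda>j. (j, x)) ` {u, v}" using e by simp
    then have "e = {(i, x), (Suc i, x)}" unfolding i(1) by simp
    then show "e \<in> ?R" using e(2) i(2,3) by (intro image_eqI[where x = "(i, x)"]) auto
  next
    fix e assume "e \<in> ?R"
    then obtain i x where e: "e = {(i, x), (Suc i, x)}" "1 \<le> i" "i < n" "x \<in> {1, 2}"
      by auto
    then have "{i, Suc i} \<in> snd (path_graph n)" by (auto simp: path_graph_def)
    moreover have "x \<in> {1..2}" using e(4) by auto
    ultimately show "e \<in> ?L" using e(1) by blast
  qed
  ultimately show ?thesis
    by (simp add: ladder_def cartesian_product_def path_graph_def)
qed

lemma ladder_1: "ladder 1 = ({(1, 1), (1, 2)}, {{(1, 1), (1, 2)}})"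
  by (rule prod_eqI) (simp_all add: ladder_vertices ladder_edges)

text \<open>The nesting of insertions is that of the glued square, with \<open>a = (n, 1)\<close>,
  \<open>b = (n, 2)\<close>, \<open>a' = (Suc n, 1)\<close> and \<open>b' = (Suc n, 2)\<close>; for
  \<open>n = 0\<close> there would be no rung to glue to.\<close>

lemma ladder_Suc:
  assumes "1 \<le> n"
  shows "ladder (Suc n) =
    (insert (Suc n, 1) (insert (Suc n, 2) (fst (ladder n))),
     insert {(n, 1), (Suc n, 1)} (insert {(n, 2), (Suc n, 2)}
       (insert {(Suc n, 1), (Suc n, 2)} (snd (ladder n)))))"
proof -
  have "{1..Suc n} = insert (Suc n) {1..n}"
    "{1..<Suc n} \<times> {1, 2::nat} = insert (n, 1) (insert (n, 2) ({1..<n} \<times> {1, 2}))"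
    using assms by auto
  then have "snd (ladder (Suc n)) = insert {(n, 1), (Suc n, 1)} (insert {(n, 2), (Suc n, 2)}
       (insert {(Suc n, 1), (Suc n, 2)} (snd (ladder n))))"
    unfolding ladder_edges
    by (simp only: image_insert prod.case Un_insert_left Un_insert_right insert_commute)
  moreover have "fst (ladder (Suc n)) = insert (Suc n, 1) (insert (Suc n, 2) (fst (ladder n)))"
    by (auto simp: ladder_vertices)
  ultimately show ?thesis by (simp add: prod_eq_iff)
qed

lemma finite_spanning_trees_ladder: "finite (spanning_trees (ladder n))"
proof (rule finite_subset)
  show "spanning_trees (ladder n) \<subseteq> Pow (Pow (fst (ladder n)))"
    by (auto simp: spanning_trees_def ladder_vertices ladder_edges)
  show "finite (Pow (Pow (fst (ladder n))))"
    by (simp add: ladder_vertices)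
qed

lemma spanning_trees_ladder_1: "spanning_trees (ladder 1) = {{{(1, 1), (1, 2)}}}"
proof -
  let ?e = "{(1, 1), (1, 2)} :: (nat \<times> nat) set"
  have "connected_graph (?e, {?e})"
    by (auto simp: connected_graph_iff respects_edges_def)
  moreover have "T \<in> spanning_trees (?e, {?e}) \<longleftrightarrow>
      T \<subseteq> {?e} \<and> Suc (card T) = card ?e \<and> connected_graph (?e, T)" for T
    by (rule spanning_trees_iff) auto
  ultimately have "T \<in> spanning_trees (?e, {?e}) \<longleftrightarrow> T = {?e}" for T
    by (cases "T = {?e}"; cases "T = {}") (simp_all add: subset_singleton_iff)
  then show ?thesis
    unfolding ladder_1 by (intro set_eqI) (simp only: singleton_iff)
qed

lemma card_spanning_trees_ladder_Suc:
  fixes n :: nat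
  defines "f \<equiv> \<lambda>n. card {T \<in> spanning_trees (ladder n). {(n, 1), (n, 2)} \<in> T}"
  assumes n: "1 \<le> n"
  shows "card (spanning_trees (ladder (Suc n))) = 3 * card (spanning_trees (ladder n)) + f n"
    and "f (Suc n) = 2 * card (spanning_trees (ladder n)) + f n"
proof -
  let ?V = "fst (ladder n)" and ?E = "snd (ladder n)"
  have "finite ?V" "\<Union>?E \<subseteq> ?V" "(n, 1) \<in> ?V" "(n, 2) \<in> ?V" "{(n, 1), (n, 2)} \<in> ?E"
    "(Suc n, 1) \<notin> ?V" "(Suc n, 2) \<notin> ?V" "(Suc n, 1::nat) \<noteq> (Suc n, 2)"
    using n by (auto simp: ladder_vertices ladder_edges)
  note c = card_spanning_trees_attach_square[OF this]
  show "card (spanning_trees (ladder (Suc n))) = 3 * card (spanning_trees (ladder n)) + f n"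
    using c(1) unfolding f_def ladder_Suc[OF n] by simp
  show "f (Suc n) = 2 * card (spanning_trees (ladder n)) + f n"
    using c(2) unfolding f_def ladder_Suc[OF n] by simp
qed

text \<open>Eliminating the rung count: \<open>f n\<close> is the excess of the next tree count over
  three times the present one. The additive form of the recurrence avoids truncated
  subtraction.\<close>

lemma card_spanning_trees_ladder:
  shows "card (spanning_trees (ladder 1)) = 1"
    and "card (spanning_trees (ladder 2)) = 4"
    and "1 \<le> n \<Longrightarrow> card (spanning_trees (ladder (n + 2))) + card (spanning_trees (ladder n)) =
      4 * card (spanning_trees (ladder (n + 1)))"
proof -
  show 1: "card (spanning_trees (ladder 1)) = 1"
    by (simp only: spanning_trees_ladder_1) simp
  have "{T \<in> spanning_trees (ladder 1). {(1, 1), (1, 2)} \<in> T} = {{{(1, 1), (1, 2)}}}"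
    by (auto simp only: spanning_trees_ladder_1)
  then show "card (spanning_trees (ladder 2)) = 4"
    using card_spanning_trees_ladder_Suc(1)[of 1] 1 by (simp add: numeral_2_eq_2)
  assume "1 \<le> n"
  then show "card (spanning_trees (ladder (n + 2))) + card (spanning_trees (ladder n)) =
      4 * card (spanning_trees (ladder (n + 1)))"
    using card_spanning_trees_ladder_Suc[of n] card_spanning_trees_ladder_Suc(1)[of "Suc n"]
    by simp
qed

section \<open>Words\<close>

lemma finite_words_avoiding_01: "finite (words_avoiding_01 m)"
  by (rule finite_subset[OF _ finite_lists_length_eq[of "{0, 1, 2, 3}" m]])
    (auto simp: words_avoiding_01_def)

lemma words_avoiding_01_0: "words_avoiding_01 0 = {[]}"
  by (auto simp: words_avoiding_01_def)

text \<open>A factor \<open>01\<close> created by prepending a letter can only start at that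
  letter.\<close>

lemma Cons_in_words_avoiding_01:
  "x # u \<in> words_avoiding_01 (Suc m) \<longleftrightarrow>
     x \<in> {0, 1, 2, 3} \<and> u \<in> words_avoiding_01 m \<and> \<not> (x = 0 \<and> prefix [1] u)"
  unfolding words_avoiding_01_def mem_Collect_eq sublist_Cons_right Cons_prefix_Cons
    list.set(2) insert_subset list.size(4)
  by (simp only: add_Suc_right add_0_right nat.inject eq_commute[of 0 x]) argo

lemma card_words_avoiding_01_1: "card (words_avoiding_01 1) = 4"
proof -
  have "words_avoiding_01 1 = (\<lambda>x. [x]) ` {0, 1, 2, 3}"
    by (auto simp: words_avoiding_01_def length_Suc_conv sublist_Cons_right)
  then show ?thesis by simp
qed

lemma card_words_avoiding_01_rec:
  "card (words_avoiding_01 (m + 2)) + card (words_avoiding_01 m) =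
     4 * card (words_avoiding_01 (m + 1))"
proof -
  let ?W = words_avoiding_01
  \<comment> \<open>The bad words: after \<open>0\<close>, the tail \<open>1 # u\<close> avoids
    \<open>01\<close> exactly when \<open>u\<close> does, since no occurrence starts with the letter
    \<open>1\<close>.\<close>
  let ?Z = "(\<lambda>u. 0 # 1 # u) ` ?W m"
  let ?A = "(\<lambda>(x, u). x # u) ` ({0, 1, 2, 3} \<times> ?W (Suc m))"
  have "?W (Suc (Suc m)) \<union> ?Z = ?A"
  proof (intro equalityI subsetI)
    fix w assume "w \<in> ?W (Suc (Suc m)) \<union> ?Z"
    moreover from this obtain x u where "w = x # u"
      by (cases w) (auto simp: words_avoiding_01_def)
    ultimately show "w \<in> ?A"
      by (auto simp: Cons_in_words_avoiding_01)
  next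
    fix w assume "w \<in> ?A"
    then obtain x u where w: "w = x # u" "x \<in> {0, 1, 2, 3}" "u \<in> ?W (Suc m)" by auto
    show "w \<in> ?W (Suc (Suc m)) \<union> ?Z"
    proof (cases "x = 0 \<and> prefix [1] u")
      case True
      then obtain v where "u = 1 # v" by (auto simp: prefix_def)
      then show ?thesis using w True by (auto simp: Cons_in_words_avoiding_01)
    next
      case False
      then show ?thesis using w by (auto simp: Cons_in_words_avoiding_01)
    qed
  qed
  moreover have "?W (Suc (Suc m)) \<inter> ?Z = {}"
    by (auto simp: Cons_in_words_avoiding_01)
  then have "card (?W (Suc (Suc m)) \<union> ?Z) = card (?W (Suc (Suc m))) + card ?Z"
    by (intro card_Un_disjoint) (auto simp: finite_words_avoiding_01)
  moreover have "card ?Z = card (?W m)"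
    by (intro card_image inj_onI) auto
  moreover have "card ?A = card ({0, 1, 2, 3 :: nat} \<times> ?W (Suc m))"
    by (intro card_image inj_onI) auto
  ultimately show ?thesis
    by (simp add: card_cartesian_product)
qed

section \<open>Colored compositions\<close>

lemma colored_compositions_0: "colored_compositions w 0 = {[]}"
proof -
  have "xs = []" if "xs \<in> colored_compositions w 0" for xs
    using that by (cases xs) (auto simp: colored_compositions_def)
  then show ?thesis by (auto simp: colored_compositions_def)
qed

text \<open>Parts are positive, so the first one is written \<open>Suc k\<close>; the bound on
  \<open>k\<close> keeps the remainder \<open>n - k\<close> free of truncation.\<close>

lemma colored_compositions_Suc:
  "colored_compositions w (Suc n) =
     (\<lambda>((k, c), xs). (Suc k, c) # xs) `
       (SIGMA (k, c) : (SIGMA k : {..n}. {..<w (Suc k)}). colored_compositions w (n - k))"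
    (is "_ = ?f ` ?S")
proof (intro equalityI subsetI)
  fix xs assume xs: "xs \<in> colored_compositions w (Suc n)"
  then obtain j c ys where eq: "xs = (j, c) # ys"
    by (cases xs) (auto simp: colored_compositions_def)
  obtain k where k: "j = Suc k"
    using xs by (cases j) (auto simp: colored_compositions_def eq)
  have "((k, c), ys) \<in> ?S" "xs = ?f ((k, c), ys)"
    using xs by (auto simp: colored_compositions_def eq k)
  then show "xs \<in> ?f ` ?S" by blast
qed (auto simp: colored_compositions_def)

lemma finite_colored_compositions: "finite (colored_compositions w n)"
proof (induction n rule: less_induct)
  case (less n)
  show ?case
  proof (cases n)
    case (Suc m)
    then show ?thesis
      using less by (auto simp: colored_compositions_Suc intro!: finite_imageI finite_SigmaI)
  qed (simp add: colored_compositions_0)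
qed

lemma card_colored_compositions_Suc:
  "card (colored_compositions w (Suc n)) =
     (\<Sum>k\<le>n. w (Suc k) * card (colored_compositions w (n - k)))"
proof -
  have "card (colored_compositions w (Suc n)) =
      card (SIGMA (k, c) : (SIGMA k : {..n}. {..<w (Suc k)}). colored_compositions w (n - k))"
    unfolding colored_compositions_Suc by (intro card_image inj_onI) auto
  also have "\<dots> = (\<Sum>(k, c) \<in> (SIGMA k : {..n}. {..<w (Suc k)}). card (colored_compositions w (n - k)))"
    by (subst card_SigmaI) (auto simp: finite_colored_compositions intro!: sum.cong)
  also have "\<dots> = (\<Sum>k\<le>n. \<Sum>c<w (Suc k). card (colored_compositions w (n - k)))"
    by (rule sum.Sigma[symmetric]) auto
  finally show ?thesis by simp
qed

lemma card_fib_compositions: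
  defines "c \<equiv> \<lambda>n. card (colored_compositions (\<lambda>k. fib (2 * k)) n)"
  shows "c 1 = 1" and "c 2 = 4" and "1 \<le> n \<Longrightarrow> c (n + 2) + c n = 4 * c (n + 1)"
proof -
  have Suc: "c (Suc n) = (\<Sum>k\<le>n. fib (2 * Suc k) * c (n - k))" for n
    unfolding c_def by (rule card_colored_compositions_Suc)
  have 0: "c 0 = 1" by (simp add: c_def colored_compositions_0)
  show 1: "c 1 = 1" using Suc[of 0] 0 by (simp add: numeral_2_eq_2)
  show "c 2 = 4" using Suc[of 1] 0 1 by (simp add: numeral_eq_Suc)
  assume "1 \<le> n"
  \<comment> \<open>Positivity matters: \<open>c 0 = 1\<close> counts the empty composition, which
    has no first part to split off.\<close>
  then obtain m where m: "n = Suc m" by (cases n) auto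
  have fib: "fib (2 * Suc (Suc k)) + fib (2 * k) = 3 * fib (2 * Suc k)" for k
    by (simp add: numeral_eq_Suc)
  have "c n = (\<Sum>k\<le>m. fib (2 * Suc k) * c (m - k))" by (simp add: m Suc)
  \<comment> \<open>The index is shifted by one at no cost because the new term at
    \<open>k = 0\<close> has the factor \<open>fib 0 = 0\<close>. Now \<open>c n\<close> and
    \<open>c (n + 2)\<close> can be added term by term.\<close>
  also have "\<dots> = (\<Sum>k\<le>n. fib (2 * k) * c (n - k))"
    unfolding m by (subst sum.atMost_Suc_shift) simp
  finally have cn: "c n = (\<Sum>k\<le>n. fib (2 * k) * c (n - k))" .
  \<comment> \<open>The term split off is the one for first part \<open>1\<close>, with
    \<open>fib 2 = 1\<close> color.\<close>
  have "c (n + 2) = c (n + 1) + (\<Sum>k\<le>n. fib (2 * Suc (Suc k)) * c (n - k))"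
    using Suc[of "Suc n"] by (subst (asm) sum.atMost_Suc_shift) (simp add: numeral_2_eq_2)
  then have "c (n + 2) + c n =
      c (n + 1) + (\<Sum>k\<le>n. (fib (2 * Suc (Suc k)) + fib (2 * k)) * c (n - k))"
    by (simp only: cn sum.distrib[symmetric] add_mult_distrib add.assoc)
  also have "\<dots> = c (n + 1) + 3 * c (n + 1)"
    by (simp only: fib Suc[of n] Suc_eq_plus1[symmetric] sum_distrib_left mult.assoc)
  finally show "c (n + 2) + c n = 4 * c (n + 1)" by simp
qed

section \<open>Comparison of the three sequences\<close>

text \<open>The recurrence has order two, so the induction carries two consecutive values;
  cancellation then determines the next one.\<close>

lemma eq_by_recurrence:
  fixes x y :: "nat \<Rightarrow> nat"
  assumes "x 1 = y 1" "x 2 = y 2"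
    and "\<And>n. 1 \<le> n \<Longrightarrow> x (n + 2) + x n = 4 * x (n + 1)"
    and "\<And>n. 1 \<le> n \<Longrightarrow> y (n + 2) + y n = 4 * y (n + 1)"
    and "1 \<le> n"
  shows "x n = y n"
proof -
  have "x (Suc m) = y (Suc m) \<and> x (Suc (Suc m)) = y (Suc (Suc m))" for m
  proof (induction m)
    case (Suc m)
    then show ?case using assms(3,4)[of "Suc m"] by simp
  qed (use assms(1,2) in \<open>simp add: numeral_2_eq_2\<close>)
  then show ?thesis using assms(5) by (cases n) auto
qed

theorem theorem4p1:
  fixes C :: "nat \<Rightarrow> (nat \<times> nat) list set"
    and S :: "nat \<Rightarrow> (nat \<times> nat) set set set"
    and W :: "nat \<Rightarrow> nat list set"
  defines "C \<equiv> \<lambda>n. colored_compositions (\<lambda>k. fib (2 * k)) n"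
    and "S \<equiv> \<lambda>n. spanning_trees (ladder n)"
    and "W \<equiv> \<lambda>n. words_avoiding_01 (n - 1)"
  shows "(\<forall>n \<ge> 1. finite (C n) \<and> finite (S n) \<and> finite (W n) \<and>
             (\<exists>f. bij_betw f (C n) (S n)) \<and> (\<exists>g. bij_betw g (C n) (W n))) \<and>
         (\<exists>a :: nat \<Rightarrow> int.
            (\<forall>n \<ge> 1. int (card (C n)) = a n \<and> int (card (S n)) = a n \<and> int (card (W n)) = a n) \<and>
            a 1 = 1 \<and> a 2 = 4 \<and> (\<forall>n \<ge> 3. a n = 4 * a (n - 1) - a (n - 2)) \<and>
            map a [1..<9] = [1, 4, 15, 56, 209, 780, 2911, 10864])"
proof -
  let ?c = "\<lambda>n. card (C n)" and ?s = "\<lambda>n. card (S n)" and ?w = "\<lambda>n. card (W n)"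
  have c: "?c 1 = 1" "?c 2 = 4" "\<And>n. 1 \<le> n \<Longrightarrow> ?c (n + 2) + ?c n = 4 * ?c (n + 1)"
    unfolding C_def by (fact card_fib_compositions)+
  have s: "?s 1 = 1" "?s 2 = 4" "\<And>n. 1 \<le> n \<Longrightarrow> ?s (n + 2) + ?s n = 4 * ?s (n + 1)"
    unfolding S_def by (fact card_spanning_trees_ladder)+
  have w: "?w 1 = 1" "?w 2 = 4"
    using card_words_avoiding_01_1 by (simp_all add: W_def words_avoiding_01_0)
  \<comment> \<open>\<open>W n\<close> holds words of length \<open>n - 1\<close>, hence the shifted
    index.\<close>
  have w_rec: "?w (n + 2) + ?w n = 4 * ?w (n + 1)" if "1 \<le> n" for n
    using card_words_avoiding_01_rec[of "n - 1"] that by (simp add: W_def)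
  have fin: "finite (C n)" "finite (S n)" "finite (W n)" for n
    unfolding C_def S_def W_def
    by (rule finite_colored_compositions finite_spanning_trees_ladder finite_words_avoiding_01)+
  have cs: "?c n = ?s n" if "1 \<le> n" for n
    using eq_by_recurrence[of ?c ?s n, OF _ _ c(3) s(3) that] c(1,2) s(1,2) by simp
  have cw: "?c n = ?w n" if "1 \<le> n" for n
    using eq_by_recurrence[of ?c ?w n, OF _ _ c(3) w_rec that] c(1,2) w by simp
  \<comment> \<open>Integer values make the subtraction in the recurrence genuine.\<close>
  define a where "a = (\<lambda>n. int (?c n))"
  have a: "a 1 = 1" "a 2 = 4" using c by (simp_all add: a_def)
  have a_rec: "a n = 4 * a (n - 1) - a (n - 2)" if n: "3 \<le> n" for n
  proof -
    define m where "m = n - 2"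
    have m: "1 \<le> m" "n = m + 2" "n - 1 = m + 1" "n - 2 = m" using n by (auto simp: m_def)
    have "a (m + 2) = 4 * a (m + 1) - a m"
      using c(3)[OF m(1)] by (simp add: a_def)
    then show ?thesis by (simp only: m(3,4) m(2)[symmetric])
  qed
  have "a 3 = 15" using a_rec[of 3] a by simp
  moreover from this have "a 4 = 56" using a_rec[of 4] a by simp
  moreover from calculation have "a 5 = 209" using a_rec[of 5] by simp
  moreover from calculation have "a 6 = 780" using a_rec[of 6] by simp
  moreover from calculation have "a 7 = 2911" using a_rec[of 7] by simp
  moreover from calculation have "a 8 = 10864" using a_rec[of 8] by simp
  moreover have "[1..<9] = [1, 2, 3, 4, 5, 6, 7, 8::nat]" by (simp add: upt_rec)
  ultimately have "map a [1..<9] = [1, 4, 15, 56, 209, 780, 2911, 10864]"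
    using a by simp
  \<comment> \<open>The bijections come from equal finite cardinalities; no explicit map is
    constructed.\<close>
  moreover have "\<exists>f. bij_betw f (C n) (S n)" "\<exists>g. bij_betw g (C n) (W n)" if "1 \<le> n" for n
    using cs[OF that] cw[OF that] fin by (simp_all add: finite_same_card_bij)
  moreover have "int (card (C n)) = a n \<and> int (card (S n)) = a n \<and> int (card (W n)) = a n"
    if "1 \<le> n" for n
    using cs[OF that] cw[OF that] by (simp add: a_def)
  ultimately show ?thesis
    using fin a a_rec by (intro conjI exI[of _ a] allI impI) simp_all
qed

end
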